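(* Let $(V,\rho,\mu,\tilde\rho,\tilde\mu)$ be a representation of a compatible pre-Lie algebra $(\mathfrak g,\cdot,\ast)$ over a field $\mathbb K$. Then $(V,\rho-\mu,\tilde\rho-\tilde\mu)$ is a representation of the sub-adjacent compatible Lie algebra $(\mathfrak g,[\cdot,\cdot],\{\cdot,\cdot\})$, where $[x,y]=x\cdot y-y\cdot x$ and $\{x,y\}=x\ast y-y\ast x$.
   Context: Pre-Lie algebra: a vector space with a bilinear product $\cdot$ satisfying $(x\cdot y)\cdot z-x\cdot(y\cdot z)=(y\cdot x)\cdot z-y\cdot(x\cdot z)$. Compatible pre-Lie algebra: a triple $(\mathfrak g,\cdot,\ast)$ where $\cdot,\ast$ are pre-Lie products such that for all $x,y,z$: $(x\ast y)\cdot z+(x\cdot y)\ast z-x\cdot(y\ast z)-x\ast(y\cdot z)-(y\ast x)\cdot z-(y\cdot x)\ast z+y\cdot(x\ast z)+y\ast(x\cdot z)=0$. Representation of a pre-Lie algebra $(\mathfrak g,\cdot)$ on $V$: linear maps $\rho,\mu:\mathfrak g\to\mathfrak{gl}(V)$ with $\rho(x\cdot y-y\cdot x)=\rho(x)\rho(y)-\rho(y)\rho(x)$ and $\mu(y)\mu(x)-\mu(x\cdot y)=\mu(y)\rho(x)-\rho(x)\mu(y)$. Representation of $(\mathfrak g,\cdot,\ast)$: $(V,\rho,\mu,\tilde\rho,\tilde\mu)$ with $(V,\rho,\mu)$ a representation of $(\mathfrak g,\cdot)$, $(V,\tilde\rho,\tilde\mu)$ a representation of $(\mathfrak g,\ast)$,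 and for all $x,y$: $\rho(x\ast y)+\tilde\rho(x\cdot y)-\rho(x)\tilde\rho(y)-\tilde\rho(x)\rho(y)=\rho(y\ast x)+\tilde\rho(y\cdot x)-\rho(y)\tilde\rho(x)-\tilde\rho(y)\rho(x)$ and $\mu(y)\tilde\rho(x)-\rho(x)\tilde\mu(y)-\mu(y)\tilde\mu(x)+\mu(x\ast y)=-\tilde\mu(y)\rho(x)+\tilde\rho(x)\mu(y)+\tilde\mu(y)\mu(x)-\tilde\mu(x\cdot y)$. Compatible Lie algebra: $(\mathfrak g,[\cdot,\cdot],\{\cdot,\cdot\})$ with two Lie brackets such that $[\{x,y\},z]+[\{y,z\},x]+[\{z,x\},y]+\{[x,y],z\}+\{[y,z],x\}+\{[z,x],y\}=0$. The commutators of the two products of a compatible pre-Lie algebra form a compatible Lie algebra, its sub-adjacent compatible Lie algebra. Representation of a compatible Lie algebra on $V$: a triple $(V,\alpha,\beta)$ with $\alpha$ a representation of $(\mathfrak g,[\cdot,\cdot])$, $\beta$ a representation of $(\mathfrak g,\{\cdot,\cdot\})$, and $\alpha(\{x,y\})+\beta([x,y])=[\alpha(x),\beta(y)]-[\alpha(y),\beta(x)]$ (commutators in $\mathfrak{gl}(V)$) for all $x,y$. *)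

theory Defs
  imports Complex_Main "HOL-Library.Function_Algebras"
begin

text \<open>
  A vector space is a type together with a scalar multiplication satisfying
  \<^locale>\<open>vector_space\<close>. Sums and differences of linear maps are the pointwise ones of
  \<^theory>\<open>HOL-Library.Function_Algebras\<close>; the product of endomorphisms is composition.
\<close>

definition bilinear_product ::
    "('k::field \<Rightarrow> 'g::ab_group_add \<Rightarrow> 'g) \<Rightarrow> ('g \<Rightarrow> 'g \<Rightarrow> 'g) \<Rightarrow> bool" where
  "bilinear_product s p \<longleftrightarrow>
     (\<forall>x. Vector_Spaces.linear s s (\<lambda>y. p x y)) \<and>
     (\<forall>y. Vector_Spaces.linear s s (\<lambda>x. p x y))"

text \<open>Used both for products on an algebra and, with \<open>(\<circ>)\<close>, for endomorphisms.\<close>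

definition commutator :: "('a::minus \<Rightarrow> 'a \<Rightarrow> 'a) \<Rightarrow> 'a \<Rightarrow> 'a \<Rightarrow> 'a" where
  "commutator p x y = p x y - p y x"

definition gl :: "('k::field \<Rightarrow> 'v::ab_group_add \<Rightarrow> 'v) \<Rightarrow> ('v \<Rightarrow> 'v) set" where
  "gl s = {A. Vector_Spaces.linear s s A}"

definition linear_into_gl ::
    "('k::field \<Rightarrow> 'g::ab_group_add \<Rightarrow> 'g) \<Rightarrow> ('k \<Rightarrow> 'v::ab_group_add \<Rightarrow> 'v) \<Rightarrow>
     ('g \<Rightarrow> 'v \<Rightarrow> 'v) \<Rightarrow> bool" where
  "linear_into_gl sg sv \<rho> \<longleftrightarrow>
     (\<forall>x. \<rho> x \<in> gl sv) \<and> Vector_Spaces.linear sg (\<lambda>c A v. sv c (A v)) \<rho>"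


section \<open>Compatible pre-Lie algebras and their representations\<close>

locale pre_lie_algebra = vector_space sg
  for sg :: "'k::field \<Rightarrow> 'g::ab_group_add \<Rightarrow> 'g" +
  fixes dot :: "'g \<Rightarrow> 'g \<Rightarrow> 'g"
  assumes bilinear: "bilinear_product sg dot"
    and pre_lie: "dot (dot x y) z - dot x (dot y z) = dot (dot y x) z - dot y (dot x z)"

locale compatible_pre_lie_algebra =
  D: pre_lie_algebra sg dot + A: pre_lie_algebra sg ast
  for sg :: "'k::field \<Rightarrow> 'g::ab_group_add \<Rightarrow> 'g"
    and dot :: "'g \<Rightarrow> 'g \<Rightarrow> 'g" (infixl "\<cdot>" 70)
    and ast :: "'g \<Rightarrow> 'g \<Rightarrow> 'g" (infixl "\<^bold>*" 70) +
  assumes compatible: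
    "(x \<^bold>* y) \<cdot> z + (x \<cdot> y) \<^bold>* z - x \<cdot> (y \<^bold>* z) - x \<^bold>* (y \<cdot> z)
     - (y \<^bold>* x) \<cdot> z - (y \<cdot> x) \<^bold>* z + y \<cdot> (x \<^bold>* z) + y \<^bold>* (x \<cdot> z) = 0"

locale pre_lie_representation =
  pre_lie_algebra sg dot + V: vector_space sv
  for sg :: "'k::field \<Rightarrow> 'g::ab_group_add \<Rightarrow> 'g"
    and dot :: "'g \<Rightarrow> 'g \<Rightarrow> 'g" (infixl "\<cdot>" 70)
    and sv :: "'k \<Rightarrow> 'v::ab_group_add \<Rightarrow> 'v" +
  fixes \<rho> \<mu> :: "'g \<Rightarrow> 'v \<Rightarrow> 'v"
  assumes rho_linear: "linear_into_gl sg sv \<rho>"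
    and mu_linear: "linear_into_gl sg sv \<mu>"
    and rho_rep: "\<rho> (x \<cdot> y - y \<cdot> x) = (\<rho> x \<circ> \<rho> y) - (\<rho> y \<circ> \<rho> x)"
    and mu_rep: "(\<mu> y \<circ> \<mu> x) - \<mu> (x \<cdot> y) = (\<mu> y \<circ> \<rho> x) - (\<rho> x \<circ> \<mu> y)"

locale compatible_pre_lie_representation =
  compatible_pre_lie_algebra sg dot ast +
  D: pre_lie_representation sg dot sv \<rho> \<mu> +
  A: pre_lie_representation sg ast sv \<rho>' \<mu>'
  for sg :: "'k::field \<Rightarrow> 'g::ab_group_add \<Rightarrow> 'g"
    and dot :: "'g \<Rightarrow> 'g \<Rightarrow> 'g" (infixl "\<cdot>" 70)
    and ast :: "'g \<Rightarrow> 'g \<Rightarrow> 'g" (infixl "\<^bold>*" 70)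
    and sv :: "'k \<Rightarrow> 'v::ab_group_add \<Rightarrow> 'v"
    and \<rho> \<mu> \<rho>' \<mu>' :: "'g \<Rightarrow> 'v \<Rightarrow> 'v" +
  assumes rho_compatible:
    "\<rho> (x \<^bold>* y) + \<rho>' (x \<cdot> y) - (\<rho> x \<circ> \<rho>' y) - (\<rho>' x \<circ> \<rho> y) =
     \<rho> (y \<^bold>* x) + \<rho>' (y \<cdot> x) - (\<rho> y \<circ> \<rho>' x) - (\<rho>' y \<circ> \<rho> x)"
    and mu_compatible:
    "(\<mu> y \<circ> \<rho>' x) - (\<rho> x \<circ> \<mu>' y) - (\<mu> y \<circ> \<mu>' x) + \<mu> (x \<^bold>* y) =
     - (\<mu>' y \<circ> \<rho> x) + (\<rho>' x \<circ> \<mu> y) + (\<mu>' y \<circ> \<mu> x) - \<mu>' (x \<cdot> y)"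


section \<open>Compatible Lie algebras and their representations\<close>

text \<open>
  The field may have characteristic 2, so a Lie bracket is required to be alternating,
  not just skew-symmetric.
\<close>

locale lie_algebra_on = vector_space sg
  for sg :: "'k::field \<Rightarrow> 'g::ab_group_add \<Rightarrow> 'g" +
  fixes br :: "'g \<Rightarrow> 'g \<Rightarrow> 'g"
  assumes bilinear: "bilinear_product sg br"
    and alternating: "br x x = 0"
    and jacobi: "br (br x y) z + br (br y z) x + br (br z x) y = 0"

locale compatible_lie_algebra =
  B: lie_algebra_on sg br + C: lie_algebra_on sg cu
  for sg :: "'k::field \<Rightarrow> 'g::ab_group_add \<Rightarrow> 'g"
    and br cu :: "'g \<Rightarrow> 'g \<Rightarrow> 'g" +
  assumes compatible:
    "br (cu x y) z + br (cu y z) x + br (cu z x) y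
     + cu (br x y) z + cu (br y z) x + cu (br z x) y = 0"

locale lie_representation =
  lie_algebra_on sg br + V: vector_space sv
  for sg :: "'k::field \<Rightarrow> 'g::ab_group_add \<Rightarrow> 'g"
    and br :: "'g \<Rightarrow> 'g \<Rightarrow> 'g"
    and sv :: "'k \<Rightarrow> 'v::ab_group_add \<Rightarrow> 'v" +
  fixes \<alpha> :: "'g \<Rightarrow> 'v \<Rightarrow> 'v"
  assumes rep_linear: "linear_into_gl sg sv \<alpha>"
    and rep_bracket: "\<alpha> (br x y) = commutator (\<circ>) (\<alpha> x) (\<alpha> y)"

locale compatible_lie_representation =
  compatible_lie_algebra sg br cu +
  B: lie_representation sg br sv \<alpha> +
  C: lie_representation sg cu sv \<beta>
  for sg :: "'k::field \<Rightarrow> 'g::ab_group_add \<Rightarrow> 'g"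
    and br cu :: "'g \<Rightarrow> 'g \<Rightarrow> 'g"
    and sv :: "'k \<Rightarrow> 'v::ab_group_add \<Rightarrow> 'v"
    and \<alpha> \<beta> :: "'g \<Rightarrow> 'v \<Rightarrow> 'v" +
  assumes rep_compatible:
    "\<alpha> (cu x y) + \<beta> (br x y) =
     commutator (\<circ>) (\<alpha> x) (\<beta> y) - commutator (\<circ>) (\<alpha> y) (\<beta> x)"

end

theory Submission
  imports Defs
begin

text \<open>
  Each identity of a (compatible) Lie algebra is the sum of the instances of the corresponding
  pre-Lie identity over the cyclic permutations of \<open>x, y, z\<close>. On the module side, the relation for
  \<open>\<rho> - \<mu>\<close> at \<open>(x, y)\<close> is the one for \<open>\<rho>\<close>, combined with the two relations for \<open>\<mu>\<close> at
  \<open>(x, y)\<close> and at \<open>(y, x)\<close>; the same combination works for the mixed relations.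
\<close>

lemma linear_diff_fun:
  assumes "Vector_Spaces.linear s t f" and "Vector_Spaces.linear s t g"
  shows "Vector_Spaces.linear s t (\<lambda>x. f x - g x)"
proof -
  \<comment> \<open>\<open>F\<close> supplies the vector space axioms for \<open>s\<close> and
    \<open>t\<close>, from which \<open>vector_space_pair\<close> is then obtained.\<close>
  interpret F: Vector_Spaces.linear s t f by fact
  interpret vector_space_pair s t by unfold_locales
  show ?thesis using assms by (rule linear_compose_sub)
qed

text \<open>\<open>linear_diff_fun\<close> applies at two levels: to the maps into all functions on
  V with pointwise scaling, and to their values at each \<open>x\<close>, which gives membership in
  \<open>gl\<close>.\<close>

lemma linear_into_gl_diff:
  assumes "linear_into_gl sg sv f" and "linear_into_gl sg sv g"
  shows "linear_into_gl sg sv (f - g)"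
proof -
  have "Vector_Spaces.linear sg (\<lambda>c A v. sv c (A v)) (\<lambda>x. f x - g x)"
    using assms by (intro linear_diff_fun) (simp_all add: linear_into_gl_def)
  moreover have "Vector_Spaces.linear sv sv (\<lambda>v. f x v - g x v)" for x
    using assms by (intro linear_diff_fun) (simp_all add: linear_into_gl_def gl_def)
  moreover have "f - g = (\<lambda>x. f x - g x)" and "(f - g) x = (\<lambda>v. f x v - g x v)" for x
    by (simp_all add: fun_eq_iff)
  ultimately show ?thesis
    by (simp only: linear_into_gl_def gl_def mem_Collect_eq) simp
qed

lemma linear_into_gl_apply_diff:
  assumes "linear_into_gl sg sv f"
  shows "f x (u - v) = f x u - f x v" and "f (x - y) = f x - f y"
proof -
  interpret L: Vector_Spaces.linear sv sv "f x"
    using assms by (simp add: linear_into_gl_def gl_def)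
  interpret R: Vector_Spaces.linear sg "\<lambda>c A v. sv c (A v)" f
    using assms by (simp add: linear_into_gl_def)
  show "f x (u - v) = f x u - f x v" "f (x - y) = f x - f y"
    by (rule L.diff R.diff)+
qed

lemma bilinear_product_diff:
  assumes "bilinear_product s p"
  shows "p (x - y) z = p x z - p y z" and "p z (x - y) = p z x - p z y"
proof -
  interpret L: Vector_Spaces.linear s s "\<lambda>y. p z y"
    using assms by (simp add: bilinear_product_def)
  interpret R: Vector_Spaces.linear s s "\<lambda>x. p x z"
    using assms by (simp add: bilinear_product_def)
  show "p (x - y) z = p x z - p y z" "p z (x - y) = p z x - p z y"
    by (rule L.diff R.diff)+
qed

lemma bilinear_product_commutator:
  assumes "bilinear_product s p"
  shows "bilinear_product s (commutator p)"
  using assms unfolding bilinear_product_def commutator_def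
  by (simp add: linear_diff_fun)

context pre_lie_algebra
begin

lemma lie_algebra_commutator: "lie_algebra_on sg (commutator dot)"
proof unfold_locales
  show "bilinear_product sg (commutator dot)"
    using bilinear by (rule bilinear_product_commutator)
  show "commutator dot x x = 0" for x
    by (simp add: commutator_def)
  \<comment> \<open>\<open>E\<close> measures the failure of the pre-Lie law. Bilinearity alone
    turns the twelve terms of the Jacobi sum into a cyclic sum of \<open>E\<close>; the law itself
    enters only through \<open>E x y z = 0\<close>.\<close>
  define E where
    "E x y z = (dot (dot x y) z - dot x (dot y z)) - (dot (dot y x) z - dot y (dot x z))" for x y z
  have "commutator dot (commutator dot x y) z + commutator dot (commutator dot y z) x
      + commutator dot (commutator dot z x) y = E x y z + E y z x + E z x y" for x y z
    by (simp add: E_def commutator_def bilinear_product_diff[OF bilinear] algebra_simps)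
  moreover have "E x y z = 0" for x y z
    using pre_lie[of x y z] by (simp add: E_def)
  ultimately show "commutator dot (commutator dot x y) z + commutator dot (commutator dot y z) x
      + commutator dot (commutator dot z x) y = 0" for x y z
    by simp
qed

end

context compatible_pre_lie_algebra
begin

lemma compatible_lie_algebra_commutator:
  "compatible_lie_algebra sg (commutator dot) (commutator ast)"
proof (intro compatible_lie_algebra.intro compatible_lie_algebra_axioms.intro
    D.lie_algebra_commutator A.lie_algebra_commutator)
  fix x y z
  \<comment> \<open>This is the polarised pre-Lie defect: the coefficient of t in the defect of the
    product \<open>dot\<close> + t \<open>ast\<close>.\<close>
  define E where
    "E x y z = (x \<^bold>* y) \<cdot> z + (x \<cdot> y) \<^bold>* z - x \<cdot> (y \<^bold>* z) - x \<^bold>* (y \<cdot> z)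
     - (y \<^bold>* x) \<cdot> z - (y \<cdot> x) \<^bold>* z + y \<cdot> (x \<^bold>* z) + y \<^bold>* (x \<cdot> z)" for x y z
  let ?b = "commutator dot" and ?c = "commutator ast"
  have "?b (?c x y) z + ?b (?c y z) x + ?b (?c z x) y
      + ?c (?b x y) z + ?c (?b y z) x + ?c (?b z x) y = E x y z + E y z x + E z x y"
    by (simp add: E_def commutator_def bilinear_product_diff[OF D.bilinear]
        bilinear_product_diff[OF A.bilinear] algebra_simps)
  moreover have "E x y z = 0" for x y z
    unfolding E_def by (rule compatible)
  ultimately show "?b (?c x y) z + ?b (?c y z) x + ?b (?c z x) y
      + ?c (?b x y) z + ?c (?b y z) x + ?c (?b z x) y = 0"
    by simp
qed

end

context pre_lie_representation
begin

lemma lie_representation_diff: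
  "lie_representation sg (commutator dot) sv (\<rho> - \<mu>)"
proof (intro lie_representation.intro lie_representation_axioms.intro
    lie_algebra_commutator V.vector_space_axioms)
  show "linear_into_gl sg sv (\<rho> - \<mu>)"
    using rho_linear mu_linear by (rule linear_into_gl_diff)
  fix x y
  note diffs = linear_into_gl_apply_diff[OF rho_linear] linear_into_gl_apply_diff[OF mu_linear]
  show "(\<rho> - \<mu>) (commutator dot x y) = commutator (\<circ>) ((\<rho> - \<mu>) x) ((\<rho> - \<mu>) y)"
  \<comment> \<open>Evaluation at a vector turns composition into iterated application, so
    additivity (\<open>diffs\<close>) reduces everything to abelian group arithmetic in V.\<close>
  proof
    fix v
    define M where "M x y = \<mu> y (\<mu> x v) - \<mu> y (\<rho> x v) + \<rho> x (\<mu> y v)" for x y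
    \<comment> \<open>\<open>mu_rep\<close> is solved for its product term. Its variables occur in
      the order \<open>y\<close>, \<open>x\<close>, so \<open>of y x\<close> swaps nothing.\<close>
    have M: "\<mu> (x \<cdot> y) v = M x y" for x y
      using fun_cong[OF mu_rep[of y x], of v] by (simp add: M_def algebra_simps)
    have "\<rho> (x \<cdot> y) v - \<rho> (y \<cdot> x) v = \<rho> x (\<rho> y v) - \<rho> y (\<rho> x v)"
      using fun_cong[OF rho_rep[of x y], of v] by (simp add: diffs)
    then have "(\<rho> - \<mu>) (commutator dot x y) v
        = \<rho> x (\<rho> y v) - \<rho> y (\<rho> x v) - (M x y - M y x)"
      by (simp add: commutator_def diffs M)
    \<comment> \<open>Antisymmetrising \<open>M\<close> produces exactly the mixed terms and the
      \<open>\<mu>\<close>-terms of the commutator of the differences.\<close>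
    then show "(\<rho> - \<mu>) (commutator dot x y) v
        = commutator (\<circ>) ((\<rho> - \<mu>) x) ((\<rho> - \<mu>) y) v"
      by (simp add: commutator_def diffs M_def algebra_simps)
  qed
qed

end

context compatible_pre_lie_representation
begin

lemma compatible_lie_representation_diff:
  "compatible_lie_representation sg (commutator dot) (commutator ast) sv (\<rho> - \<mu>) (\<rho>' - \<mu>')"
proof (intro compatible_lie_representation.intro compatible_lie_representation_axioms.intro
    compatible_lie_algebra_commutator D.lie_representation_diff A.lie_representation_diff)
  fix x y
  note diffs = linear_into_gl_apply_diff[OF D.rho_linear] linear_into_gl_apply_diff[OF D.mu_linear]
    linear_into_gl_apply_diff[OF A.rho_linear] linear_into_gl_apply_diff[OF A.mu_linear]
  show "(\<rho> - \<mu>) (commutator ast x y) + (\<rho>' - \<mu>') (commutator dot x y) =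
      commutator (\<circ>) ((\<rho> - \<mu>) x) ((\<rho>' - \<mu>') y) - commutator (\<circ>) ((\<rho> - \<mu>) y) ((\<rho>' - \<mu>') x)"
    (is "?L = ?R")
  proof
    fix v
    \<comment> \<open>\<open>M\<close> polarises the formula \<mu>(y)\<mu>(x) - \<mu>(y)\<rho>(x) +
      \<rho>(x)\<mu>(y) for \<mu> of a product, replacing one factor at a time by its primed
      version; \<open>N\<close> does the same to \<rho>(x)\<rho>(y).\<close>
    define M where "M x y = \<mu>' y (\<mu> x v) + \<mu> y (\<mu>' x v) - \<mu>' y (\<rho> x v) - \<mu> y (\<rho>' x v)
      + \<rho>' x (\<mu> y v) + \<rho> x (\<mu>' y v)" for x y
    define N where "N x y = \<rho> x (\<rho>' y v) + \<rho>' x (\<rho> y v)" for x y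
    have M: "\<mu> (x \<^bold>* y) v + \<mu>' (x \<cdot> y) v = M x y" for x y
      using fun_cong[OF mu_compatible[of y x], of v] by (simp add: M_def algebra_simps)
    have N: "(\<rho> (x \<^bold>* y) v + \<rho>' (x \<cdot> y) v) - (\<rho> (y \<^bold>* x) v + \<rho>' (y \<cdot> x) v) = N x y - N y x"
      using fun_cong[OF rho_compatible[of x y], of v] by (simp add: N_def algebra_simps)
    \<comment> \<open>The mixed relations control only sums of an unprimed and a primed term, and
      for \<rho> only their antisymmetrised form, so the terms are grouped to match \<open>M\<close>
      and \<open>N\<close>.\<close>
    have "?L v = ((\<rho> (x \<^bold>* y) v + \<rho>' (x \<cdot> y) v) - (\<rho> (y \<^bold>* x) v + \<rho>' (y \<cdot> x) v))
        - ((\<mu> (x \<^bold>* y) v + \<mu>' (x \<cdot> y) v) - (\<mu> (y \<^bold>* x) v + \<mu>' (y \<cdot> x) v))"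
      by (simp add: commutator_def diffs algebra_simps)
    also have "\<dots> = N x y - N y x - (M x y - M y x)"
      by (simp only: M N)
    also have "\<dots> = ?R v"
      by (simp add: commutator_def diffs M_def N_def algebra_simps)
    finally show "?L v = ?R v" .
  qed
qed

end

theorem proposition2p11:
  fixes sg :: "'k::field \<Rightarrow> 'g::ab_group_add \<Rightarrow> 'g"
    and dot ast :: "'g \<Rightarrow> 'g \<Rightarrow> 'g"
    and sv :: "'k \<Rightarrow> 'v::ab_group_add \<Rightarrow> 'v"
    and \<rho> \<mu> \<rho>' \<mu>' :: "'g \<Rightarrow> 'v \<Rightarrow> 'v"
  assumes "compatible_pre_lie_representation sg dot ast sv \<rho> \<mu> \<rho>' \<mu>'"
  shows "compatible_lie_representation sg (commutator dot) (commutator ast) sv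
           (\<rho> - \<mu>) (\<rho>' - \<mu>')"
  using assms
  by (rule compatible_pre_lie_representation.compatible_lie_representation_diff)

end
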